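(* Let $\mathcal{Q}$ be a thick finite generalized quadrangle of order $(s,t)$, where $t > s$ and $t+1$ is prime. If \[ t \left\lceil \left\lceil \frac{s^2}{t+1}\right\rceil\left(\frac{t+1}{s} \right) \right\rceil > s(s+t),\] then $\mathcal{Q}$ does not have an automorphism of order $t+1$, and the automorphism group of $\mathcal{Q}$ is not transitive on the lines of $\mathcal{Q}$.
   Context: A finite generalized quadrangle of order $(s,t)$, with $s,t$ positive integers, is an incidence structure consisting of a finite set $\mathcal{P}$ of points, a finite set $\mathcal{L}$ of lines disjoint from $\mathcal{P}$, and a symmetric point-line incidence relation such that: each point is incident with exactly $t+1$ lines and each line is incident with exactly $s+1$ points; two distinct points are mutually incident with at most one line, and two distinct lines are mutually incident with at most one point; and for each point $P$ and each line $\ell$ not incident with $P$ there is a unique pair $(P',\ell') \in \mathcal{P}\times\mathcal{L}$ such that $P$ is incident with $\ell'$, $\ell'$ is incident with $P'$, and $P'$ is incident with $\ell$. It is thick if $s>1$ and $t>1$. An automorphism of $\mathcal{Q}$ is a permutation of the point set that preserves collinearity (two points are collinear if some line is incident with both); it induces a permutation of the lines preserving incidence, and in this way the automorphism group acts on the lines. The order of an automorphism is its order as an element of the automorphism group. *)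

theory Defs
  imports
    "HOL-Combinatorics.Permutations"
    "HOL-Computational_Algebra.Primes"
    "HOL-Algebra.Group_Action"
    "HOL-Algebra.Multiplicative_Group"
begin

text \<open>
  Points and lines live in separate types, so the two sets are disjoint; \<^term>\<open>I x l\<close> says that
  the point \<^term>\<open>x\<close> and the line \<^term>\<open>l\<close> are incident, and only its values on \<^term>\<open>P \<times> L\<close> matter.
  Nonemptiness only excludes the structure with neither points nor lines, which would otherwise
  satisfy all the axioms vacuously.
\<close>

locale generalized_quadrangle =
  fixes P :: "'p set" and L :: "'l set" and I :: "'p \<Rightarrow> 'l \<Rightarrow> bool" and s t :: nat
  assumes s_pos: "s \<ge> 1" and t_pos: "t \<ge> 1"
    and finite_points: "finite P" and finite_lines: "finite L"
    and points_nonempty: "P \<noteq> {}"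
    and lines_per_point: "\<And>x. x \<in> P \<Longrightarrow> card {l \<in> L. I x l} = t + 1"
    and points_per_line: "\<And>l. l \<in> L \<Longrightarrow> card {x \<in> P. I x l} = s + 1"
    and two_points: "\<And>x y. x \<in> P \<Longrightarrow> y \<in> P \<Longrightarrow> x \<noteq> y \<Longrightarrow> card {l \<in> L. I x l \<and> I y l} \<le> 1"
    and two_lines: "\<And>l m. l \<in> L \<Longrightarrow> m \<in> L \<Longrightarrow> l \<noteq> m \<Longrightarrow> card {x \<in> P. I x l \<and> I x m} \<le> 1"
    and projection: "\<And>x l. x \<in> P \<Longrightarrow> l \<in> L \<Longrightarrow> \<not> I x l \<Longrightarrow>
      \<exists>!q. q \<in> P \<times> L \<and> (case q of (y, m) \<Rightarrow> I x m \<and> I y m \<and> I y l)"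

locale thick_generalized_quadrangle = generalized_quadrangle +
  assumes s_gt_1: "s > 1" and t_gt_1: "t > 1"

definition gq_collinear :: "'l set \<Rightarrow> ('p \<Rightarrow> 'l \<Rightarrow> bool) \<Rightarrow> 'p \<Rightarrow> 'p \<Rightarrow> bool" where
  "gq_collinear L I x y \<longleftrightarrow> (\<exists>l\<in>L. I x l \<and> I y l)"

text \<open>As \<^term>\<open>P\<close> is finite, preserving collinearity in one direction already gives a group.\<close>

definition gq_aut_group :: "'p set \<Rightarrow> 'l set \<Rightarrow> ('p \<Rightarrow> 'l \<Rightarrow> bool) \<Rightarrow> ('p \<Rightarrow> 'p) monoid" where
  "gq_aut_group P L I =
    \<lparr>carrier = {g. g permutes P \<and>
        (\<forall>x\<in>P. \<forall>y\<in>P. gq_collinear L I x y \<longrightarrow> gq_collinear L I (g x) (g y))},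
     mult = (\<circ>), one = id\<rparr>"

text \<open>
  The induced permutation of the lines: a line goes to the line whose points are the images of its
  points. It is well defined and an action by \<open>gq_line_action\<close> below.
\<close>

definition gq_on_lines ::
    "'p set \<Rightarrow> 'l set \<Rightarrow> ('p \<Rightarrow> 'l \<Rightarrow> bool) \<Rightarrow> ('p \<Rightarrow> 'p) \<Rightarrow> 'l \<Rightarrow> 'l" where
  "gq_on_lines P L I g =
    (\<lambda>l\<in>L. THE m. m \<in> L \<and> {x \<in> P. I x m} = g ` {x \<in> P. I x l})"

lemma gq_aut_group_collinear_iff:
  assumes "finite P" "g \<in> carrier (gq_aut_group P L I)" "x \<in> P" "y \<in> P"
  shows "gq_collinear L I (g x) (g y) \<longleftrightarrow> gq_collinear L I x y"
proof
  assume h: "gq_collinear L I (g x) (g y)"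
  have g: "g permutes P"
    and pres: "\<And>x y. x \<in> P \<Longrightarrow> y \<in> P \<Longrightarrow> gq_collinear L I x y \<Longrightarrow> gq_collinear L I (g x) (g y)"
    using assms(2) by (auto simp: gq_aut_group_def)
  define A where "A = {(x, y). x \<in> P \<and> y \<in> P \<and> gq_collinear L I x y}"
  have "finite A"
    by (rule finite_subset[of _ "P \<times> P"]) (use assms(1) in \<open>auto simp: A_def\<close>)
  moreover have "map_prod g g ` A \<subseteq> A"
    using pres permutes_in_image[OF g] by (auto simp: A_def)
  moreover have "inj_on (map_prod g g) A"
    using prod.inj_map[OF permutes_inj[OF g] permutes_inj[OF g]] by (rule inj_on_subset) simp
  ultimately have "map_prod g g ` A = A"
    by (rule endo_inj_surj)
  moreover have "(g x, g y) \<in> A"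
    using h assms(3,4) permutes_in_image[OF g] by (auto simp: A_def)
  ultimately have "(g x, g y) \<in> map_prod g g ` A"
    by simp
  then show "gq_collinear L I x y"
    by (auto simp: A_def dest!: injD[OF permutes_inj[OF g]])
qed (use assms in \<open>auto simp: gq_aut_group_def\<close>)

lemma group_gq_aut_group:
  assumes "finite P"
  shows "group (gq_aut_group P L I)"
proof (rule groupI)
  fix g assume g: "g \<in> carrier (gq_aut_group P L I)"
  then have p: "g permutes P"
    by (simp add: gq_aut_group_def)
  have "gq_collinear L I (Hilbert_Choice.inv g x) (Hilbert_Choice.inv g y)" if "x \<in> P" "y \<in> P" "gq_collinear L I x y" for x y
    using gq_aut_group_collinear_iff[OF assms g, of "Hilbert_Choice.inv g x" "Hilbert_Choice.inv g y"] that
    by (simp add: permutes_inverses[OF p] permutes_in_image[OF permutes_inv[OF p]])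
  then have "Hilbert_Choice.inv g \<in> carrier (gq_aut_group P L I)"
    using permutes_inv[OF p] by (simp add: gq_aut_group_def)
  then show "\<exists>h\<in>carrier (gq_aut_group P L I). h \<otimes>\<^bsub>gq_aut_group P L I\<^esub> g = \<one>\<^bsub>gq_aut_group P L I\<^esub>"
    by (intro bexI[of _ "Hilbert_Choice.inv g"]) (simp_all add: gq_aut_group_def permutes_inv_o[OF p])
next
  fix g h assume g: "g \<in> carrier (gq_aut_group P L I)" and h: "h \<in> carrier (gq_aut_group P L I)"
  then have "g permutes P" and p: "h permutes P"
    by (simp_all add: gq_aut_group_def)
  then have "g \<circ> h permutes P"
    by (intro permutes_compose)
  then show "g \<otimes>\<^bsub>gq_aut_group P L I\<^esub> h \<in> carrier (gq_aut_group P L I)"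
    using g h permutes_in_image[OF p] by (simp add: gq_aut_group_def)
next
  show "\<one>\<^bsub>gq_aut_group P L I\<^esub> \<in> carrier (gq_aut_group P L I)"
    by (simp add: gq_aut_group_def permutes_def)
next
  show "f \<otimes>\<^bsub>gq_aut_group P L I\<^esub> g \<otimes>\<^bsub>gq_aut_group P L I\<^esub> h
      = f \<otimes>\<^bsub>gq_aut_group P L I\<^esub> (g \<otimes>\<^bsub>gq_aut_group P L I\<^esub> h)" for f g h
    by (simp add: gq_aut_group_def comp_assoc)
next
  show "\<one>\<^bsub>gq_aut_group P L I\<^esub> \<otimes>\<^bsub>gq_aut_group P L I\<^esub> g = g" for g
    by (simp add: gq_aut_group_def)
qed

context generalized_quadrangle
begin

lemma point_unique:
  assumes "l \<in> L" "m \<in> L" "l \<noteq> m" "x \<in> P" "y \<in> P" "I x l" "I x m" "I y l" "I y m"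
  shows "x = y"
proof -
  have "finite {x \<in> P. I x l \<and> I x m}"
    using finite_points by simp
  then show ?thesis
    using two_lines[OF assms(1-3)] assms by (auto simp: card_le_Suc0_iff_eq)
qed

lemma line_two_points:
  assumes "l \<in> L"
  obtains x y where "x \<in> P" "y \<in> P" "x \<noteq> y" "I x l" "I y l"
proof -
  have "\<not> card {x \<in> P. I x l} \<le> Suc 0"
    using points_per_line[OF assms] s_pos by simp
  moreover have "finite {x \<in> P. I x l}"
    using finite_points by simp
  ultimately show ?thesis
    using that by (auto simp: card_le_Suc0_iff_eq)
qed

lemma line_eqI:
  assumes "l \<in> L" "m \<in> L" "{x \<in> P. I x l} = {x \<in> P. I x m}"
  shows "l = m"
proof -
  obtain x y where "x \<in> P" "y \<in> P" "x \<noteq> y" "I x l" "I y l"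
    using line_two_points[OF assms(1)] .
  then show ?thesis
    using point_unique[of l m x y] assms by blast
qed

lemma line_points_eq:
  assumes l: "l \<in> L" and xy: "x \<in> P" "y \<in> P" "x \<noteq> y" "I x l" "I y l"
  shows "{z \<in> P. I z l} = {z \<in> P. gq_collinear L I z x \<and> gq_collinear L I z y}"
proof (intro Set.set_eqI iffI)
  fix z assume "z \<in> {z \<in> P. gq_collinear L I z x \<and> gq_collinear L I z y}"
  then obtain m n where z: "z \<in> P" and m: "m \<in> L" "I z m" "I x m" and n: "n \<in> L" "I z n" "I y n"
    by (auto simp: gq_collinear_def)
  have "I z l"
  proof (rule ccontr)
    assume "\<not> I z l"
    from projection[OF z l this] have "(x, m) = (y, n)"
      using m n xy by blast
    with xy show False by simp
  qed
  with z show "z \<in> {z \<in> P. I z l}" by simp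
qed (use assms in \<open>auto simp: gq_collinear_def\<close>)

lemma gq_aut_line_image:
  assumes g: "g \<in> carrier (gq_aut_group P L I)" and l: "l \<in> L"
  shows "\<exists>!m. m \<in> L \<and> {x \<in> P. I x m} = g ` {x \<in> P. I x l}"
proof -
  have p: "g permutes P"
    using g by (simp add: gq_aut_group_def)
  note in_P = permutes_in_image[OF p]
  note col = gq_aut_group_collinear_iff[OF finite_points g]
  obtain x y where xy: "x \<in> P" "y \<in> P" "x \<noteq> y" "I x l" "I y l"
    using line_two_points[OF l] .
  then have "gq_collinear L I (g x) (g y)"
    using l col by (auto simp: gq_collinear_def)
  then obtain m where m: "m \<in> L" "I (g x) m" "I (g y) m"
    by (auto simp: gq_collinear_def)
  have ne: "g x \<noteq> g y"
    using xy permutes_inj[OF p] by (auto simp: inj_eq)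
  have "{z \<in> P. I z m} = {z \<in> P. gq_collinear L I z (g x) \<and> gq_collinear L I z (g y)}"
    using line_points_eq[of m "g x" "g y"] m xy ne in_P by blast
  also have "\<dots> = g ` {z \<in> P. gq_collinear L I z x \<and> gq_collinear L I z y}"
  proof (intro Set.set_eqI iffI)
    fix z assume z: "z \<in> {z \<in> P. gq_collinear L I z (g x) \<and> gq_collinear L I z (g y)}"
    then obtain w where w: "w \<in> P" "z = g w"
      using permutes_image[OF p] by blast
    then have "w \<in> {z \<in> P. gq_collinear L I z x \<and> gq_collinear L I z y}"
      using z col xy by simp
    with w show "z \<in> g ` {z \<in> P. gq_collinear L I z x \<and> gq_collinear L I z y}"
      by blast
  qed (use col xy in_P in auto)
  also have "\<dots> = g ` {x \<in> P. I x l}"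
    using line_points_eq[OF l xy] by simp
  finally have eq: "{z \<in> P. I z m} = g ` {x \<in> P. I x l}" .
  show ?thesis
  proof (rule ex1I[of _ m])
    fix n assume "n \<in> L \<and> {x \<in> P. I x n} = g ` {x \<in> P. I x l}"
    then show "n = m"
      using line_eqI[of n m] m(1) eq by simp
  qed (use m(1) eq in simp)
qed

lemma gq_on_lines:
  assumes "g \<in> carrier (gq_aut_group P L I)" "l \<in> L"
  shows "gq_on_lines P L I g l \<in> L"
    and "{x \<in> P. I x (gq_on_lines P L I g l)} = g ` {x \<in> P. I x l}"
proof -
  have "gq_on_lines P L I g l = (THE m. m \<in> L \<and> {x \<in> P. I x m} = g ` {x \<in> P. I x l})"
    using assms(2) by (simp add: gq_on_lines_def)
  with theI'[OF gq_aut_line_image[OF assms]]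
  have "gq_on_lines P L I g l \<in> L \<and> {x \<in> P. I x (gq_on_lines P L I g l)} = g ` {x \<in> P. I x l}"
    by (simp only:)
  then show "gq_on_lines P L I g l \<in> L"
    and "{x \<in> P. I x (gq_on_lines P L I g l)} = g ` {x \<in> P. I x l}"
    by blast+
qed

lemma gq_on_lines_Bij:
  assumes g: "g \<in> carrier (gq_aut_group P L I)"
  shows "gq_on_lines P L I g \<in> Bij L"
proof -
  have p: "g permutes P"
    using g by (simp add: gq_aut_group_def)
  have "inj_on (gq_on_lines P L I g) L"
  proof (rule inj_onI)
    fix l m assume lm: "l \<in> L" "m \<in> L" "gq_on_lines P L I g l = gq_on_lines P L I g m"
    then have "g ` {x \<in> P. I x l} = g ` {x \<in> P. I x m}"
      using gq_on_lines(2)[OF g] by metis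
    then have "{x \<in> P. I x l} = {x \<in> P. I x m}"
      using permutes_inj[OF p] by (simp add: inj_image_eq_iff)
    then show "l = m"
      using line_eqI lm by blast
  qed
  moreover from this have "gq_on_lines P L I g ` L = L"
    using gq_on_lines(1)[OF g] finite_lines by (intro endo_inj_surj) auto
  ultimately show ?thesis
    by (simp add: Bij_def bij_betw_def) (simp add: gq_on_lines_def)
qed

lemma gq_line_action: "group_action (gq_aut_group P L I) L (gq_on_lines P L I)"
proof -
  have "gq_on_lines P L I (g \<circ> h) = compose L (gq_on_lines P L I g) (gq_on_lines P L I h)"
    if g: "g \<in> carrier (gq_aut_group P L I)" and h: "h \<in> carrier (gq_aut_group P L I)" for g h
  proof (rule extensionalityI[of _ L])
    fix l assume l: "l \<in> L"
    have gh: "g \<circ> h \<in> carrier (gq_aut_group P L I)"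
      using group.is_monoid[OF group_gq_aut_group[OF finite_points], THEN monoid.m_closed, OF g h]
      by (simp add: gq_aut_group_def)
    have hl: "gq_on_lines P L I h l \<in> L"
      using gq_on_lines(1)[OF h l] .
    have "gq_on_lines P L I (g \<circ> h) l = gq_on_lines P L I g (gq_on_lines P L I h l)"
    proof (rule line_eqI)
      show "{x \<in> P. I x (gq_on_lines P L I (g \<circ> h) l)}
          = {x \<in> P. I x (gq_on_lines P L I g (gq_on_lines P L I h l))}"
        by (simp only: gq_on_lines(2)[OF gh l] gq_on_lines(2)[OF g hl] gq_on_lines(2)[OF h l] image_comp)
    qed (use gq_on_lines(1)[OF gh l] gq_on_lines(1)[OF g hl] in simp_all)
    then show "gq_on_lines P L I (g \<circ> h) l
        = compose L (gq_on_lines P L I g) (gq_on_lines P L I h) l"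
      using l by (simp add: compose_def)
  qed (auto simp: gq_on_lines_def compose_def)
  then have "gq_on_lines P L I \<in> hom (gq_aut_group P L I) (BijGroup L)"
    using gq_on_lines_Bij by (auto simp: hom_def BijGroup_def gq_aut_group_def)
  then show ?thesis
    using group_gq_aut_group[OF finite_points] group_BijGroup
    by (auto simp: group_action_def group_hom_def group_hom_axioms_def)
qed

end

end

theory Submission
  imports Defs "HOL-Algebra.Sylow"
begin

text \<open>
  Let \<open>g\<close> be an automorphism of prime order \<open>p = t + 1\<close>, where \<open>s < t\<close>. The theorem follows from the
  reverse of the assumed inequality, proved for such a \<open>g\<close> in \<open>prime_order_aut_bound\<close>.

  All orbits of \<open>g\<close> have \<open>1\<close> or \<open>p\<close> elements, so a set that \<open>g\<close> preserves is fixed pointwise as soon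
  as fewer than \<open>p\<close> of its elements are moved. A line has only \<open>s + 1 < p\<close> points, and a point has
  exactly \<open>p\<close> lines, so the points of a fixed line are fixed, and so are all lines through such a
  point. Every point is reached in this way, hence a fixed line forces \<open>g\<close> to be the identity
  (\<open>fixed_line_imp_id\<close>). Therefore \<open>g\<close> fixes no line and the fixed points are pairwise noncollinear.

  Counting points modulo \<open>p\<close>, the number \<open>f\<close> of fixed points satisfies \<open>f - 1 + s\<^sup>2 = c (t + 1)\<close> for
  some integer \<open>c\<close>. Moreover \<open>f\<close> is positive, as \<open>p\<close> does not divide \<open>(s - 1)(s + 1)\<close>; hence
  \<open>c \<ge> \<lceil>s\<^sup>2 / (t + 1)\<rceil>\<close>.

  For an upper bound on \<open>f\<close>, take a line \<open>l\<close> through a fixed point \<open>x\<close>. Each of the other \<open>f - 1\<close>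
  fixed points is collinear with exactly one of the \<open>s\<close> points of \<open>l\<close> other than \<open>x\<close>, so some such
  point \<open>y\<close> is collinear with \<open>b \<ge> (f - 1) / s\<close> of them, and with \<open>x\<close>. All the \<open>t + 1\<close> points of the
  orbit of \<open>y\<close> are then collinear with these \<open>b + 1\<close> fixed points. The images of \<open>l\<close> are distinct lines
  through \<open>x\<close>, so the points of the orbit are pairwise noncollinear. Two disjoint
  nonempty sets of \<open>m\<close> and \<open>n\<close> pairwise noncollinear points that are completely joined to each other satisfy \<open>(m - 1)(n - 1) \<le> s\<^sup>2\<close>
  (\<open>bicollinear_cocliques_bound\<close>), because the form \<open>s I - N + J / (s + 1)\<close> is positive semidefinite,
  where \<open>N\<close> is the matrix of collinearity and \<open>J\<close> the all-ones matrix (\<open>coll_form_le\<close>). Hence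
  \<open>b t \<le> s\<^sup>2\<close>.

  Together, \<open>c (t + 1) / s \<le> b + s\<close>, where the right-hand side is an integer with
  \<open>t (b + s) \<le> s (s + t)\<close>. This is the desired inequality.

  If the automorphism group is transitive on lines, then the number \<open>(t + 1)(s t + 1)\<close> of lines
  divides its order, and Cauchy's theorem provides an automorphism of order \<open>t + 1\<close>.
\<close>

section \<open>Maps of prime period\<close>

lemma funpow_period_mult:
  assumes "(f ^^ k) x = x"
  shows "(f ^^ (k * n)) x = x"
  using funpow_mod_eq[OF assms, of "k * n"] by simp

text \<open>The periods of a point are closed under the Euclidean algorithm, so two coprime periods force
  the period one.\<close>

lemma fixed_if_prime_period:
  assumes p: "Factorial_Ring.prime p" and fp: "(f ^^ p) x = x"
    and fk: "(f ^^ k) x = x" and k: "0 < k" "k < p"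
  shows "f x = x"
proof -
  have "coprime k p"
    using p k by (metis coprime_commute linorder_not_less nat_dvd_not_less prime_imp_coprime)
  then obtain a b where ab: "k * a = p * b + 1"
    using bezout_nat[of k p] k by auto
  have "x = (f ^^ (k * a)) x"
    using funpow_period_mult[OF fk] by simp
  also have "\<dots> = f ((f ^^ (p * b)) x)"
    unfolding ab by simp
  also have "\<dots> = f x"
    using funpow_period_mult[OF fp] by simp
  finally show ?thesis by simp
qed

text \<open>The points that are not fixed fall into orbits, and by the previous lemma the first \<^term>\<open>p\<close>
  iterates of such a point are distinct.\<close>

lemma prime_dvd_card_nonfixed:
  assumes p: "Factorial_Ring.prime p" and fin: "finite S"
    and inv: "\<And>x. x \<in> S \<Longrightarrow> f x \<in> S" and per: "\<And>x. x \<in> S \<Longrightarrow> (f ^^ p) x = x"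
  shows "p dvd card {x \<in> S. f x \<noteq> x}"
proof -
  define N where "N = {x \<in> S. f x \<noteq> x}"
  define orb where "orb x = (\<lambda>i. (f ^^ i) x) ` {..<p}" for x
  have p0: "0 < p"
    using p by (simp add: prime_gt_0_nat)
  have cycle_eq: "f x = x" if "x \<in> S" "i < j" "j < p" "(f ^^ i) x = (f ^^ j) x" for x i j
  proof (rule fixed_if_prime_period[OF p per[OF that(1)]])
    have "(f ^^ (p - j + i)) x = (f ^^ (p - j + j)) x"
      using that(4) unfolding funpow_add by simp
    then show "(f ^^ (p - j + i)) x = x"
      using per[OF that(1)] that(3) by simp
  qed (use that in auto)
  have inS: "(f ^^ i) x \<in> S" if "x \<in> S" for x i
    by (induction i) (use that inv in auto)
  have inN: "(f ^^ i) x \<in> N" if "x \<in> N" for x i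
  proof (rule ccontr)
    have x: "x \<in> S" "f x \<noteq> x"
      using that by (auto simp: N_def)
    assume "(f ^^ i) x \<notin> N"
    then have fx: "f ((f ^^ i) x) = (f ^^ i) x"
      using inS[OF x(1), of i] by (simp add: N_def)
    then have const: "(f ^^ n) ((f ^^ i) x) = (f ^^ i) x" for n
      by (induction n) auto
    have "x = (f ^^ (p * i)) x"
      using funpow_period_mult[OF per[OF x(1)]] by simp
    also have "p * i = (p * i - i) + i"
      using p0 by simp
    also have "(f ^^ \<dots>) x = (f ^^ i) x"
      using const by (simp only: funpow_add o_apply)
    finally show False
      using fx x(2) by simp
  qed
  have orbN: "orb x \<subseteq> N" if "x \<in> N" for x
    using inN that by (auto simp: orb_def)
  have self: "x \<in> orb x" for x
    using p0 unfolding orb_def by (metis funpow_0 imageI lessThan_iff)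
  have orb_range: "orb x = range (\<lambda>i. (f ^^ i) x)" if "x \<in> S" for x
    unfolding orb_def
  proof (intro equalityI subsetI)
    fix z assume "z \<in> range (\<lambda>i. (f ^^ i) x)"
    then obtain i where "z = (f ^^ i) x" by auto
    then have "z = (f ^^ (i mod p)) x"
      using funpow_mod_eq[OF per[OF that]] by simp
    then show "z \<in> (\<lambda>i. (f ^^ i) x) ` {..<p}"
      using p0 by auto
  qed auto
  have orb_eq: "orb z = orb x" if x: "x \<in> S" and z: "z \<in> orb x" for x z
  proof -
    obtain i where i: "i < p" "z = (f ^^ i) x"
      using z by (auto simp: orb_def)
    have zS: "z \<in> S"
      using i inS x by simp
    have "(f ^^ n) x = (f ^^ (n + (p - i))) z" for n
    proof -
      have "(f ^^ (n + (p - i))) z = (f ^^ (n + (p - i) + i)) x"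
        unfolding i(2) by (simp add: funpow_add)
      also have "\<dots> = (f ^^ n) ((f ^^ p) x)"
        using i(1) by (simp add: funpow_add[symmetric, THEN fun_cong, unfolded o_apply])
      finally show ?thesis
        using per[OF x] by simp
    qed
    moreover have "(f ^^ n) z = (f ^^ (n + i)) x" for n
      unfolding i(2) by (simp add: funpow_add)
    ultimately show ?thesis
      unfolding orb_range[OF zS] orb_range[OF x] by (auto simp: image_iff)
  qed
  have card: "card (orb x) = p" if "x \<in> N" for x
  proof -
    have "x \<in> S" "f x \<noteq> x"
      using that by (auto simp: N_def)
    then have "inj_on (\<lambda>i. (f ^^ i) x) {..<p}"
      using cycle_eq by (auto simp: inj_on_def) (metis nat_neq_iff)
    then show ?thesis
      unfolding orb_def by (simp add: card_image)
  qed
  have "\<Union> (orb ` N) = N"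
    using orbN self by blast
  moreover have "p dvd card (\<Union> (orb ` N))"
  proof (rule dvd_partition)
    show "finite (\<Union> (orb ` N))"
      using \<open>\<Union> (orb ` N) = N\<close> fin by (simp add: N_def)
    show "\<forall>c\<in>orb ` N. p dvd card c"
      using card by auto
    have "orb x = orb y" if "x \<in> S" "y \<in> S" "z \<in> orb x" "z \<in> orb y" for x y z
      using orb_eq[OF that(1,3)] orb_eq[OF that(2,4)] by simp
    then show "\<forall>c1\<in>orb ` N. \<forall>c2\<in>orb ` N. c1 \<noteq> c2 \<longrightarrow> c1 \<inter> c2 = {}"
      unfolding N_def by blast
  qed
  ultimately show ?thesis
    by (simp add: N_def)
qed

text \<open>This is how the smallness of \<^term>\<open>s\<close> against \<^term>\<open>t + 1\<close> enters: it makes fixed lines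
  pointwise fixed.\<close>

lemma all_fixed_if_few_nonfixed:
  assumes "Factorial_Ring.prime p" "finite S" "\<And>x. x \<in> S \<Longrightarrow> f x \<in> S" "\<And>x. x \<in> S \<Longrightarrow> (f ^^ p) x = x"
    and "card {x \<in> S. f x \<noteq> x} < p" and "x \<in> S"
  shows "f x = x"
proof -
  have "card {x \<in> S. f x \<noteq> x} = 0"
    using prime_dvd_card_nonfixed[of p S f] assms by (meson gr0I nat_dvd_not_less)
  then show ?thesis
    using assms(2,6) by auto
qed

section \<open>Elements of prime order\<close>

text \<open>
  Cauchy's theorem: Sylow's theorem with exponent one gives a subgroup with \<^term>\<open>p\<close> elements, and
  the order of each of its elements other than the identity divides \<^term>\<open>p\<close>.
\<close>

lemma (in group) exists_prime_order_element:
  assumes p: "Factorial_Ring.prime p" and fin: "finite (carrier G)" and dvd: "p dvd order G"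
  shows "\<exists>g\<in>carrier G. ord g = p"
proof -
  obtain m where "order G = p ^ 1 * m"
    using dvd by auto
  then obtain H where H: "subgroup H G" "card H = p"
    using sylow_thm[OF p is_group _ fin] by (metis power_one_right)
  then have "H \<noteq> {\<one>}"
    using p by auto
  then obtain g where g: "g \<in> H" "g \<noteq> \<one>"
    using H(1) subgroup.one_closed by blast
  have gG: "g \<in> carrier G"
    using subgroup.mem_carrier[OF H(1) g(1)] .
  interpret H: group "G\<lparr>carrier := H\<rparr>"
    using subgroup.subgroup_is_group[OF H(1) is_group] .
  have "g [^]\<^bsub>G\<lparr>carrier := H\<rparr>\<^esub> order (G\<lparr>carrier := H\<rparr>) = \<one>"
    using H.pow_order_eq_1[of g] g(1) by simp
  then have "g [^] p = \<one>"
    using H(2) nat_pow_consistent[of g p H] by (simp add: order_def)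
  then have "ord g dvd p"
    using pow_eq_id gG by blast
  moreover have "ord g \<noteq> 1"
    using ord_eq_1 gG g(2) by blast
  ultimately show ?thesis
    using p gG by (metis prime_nat_iff)
qed

section \<open>Counting points and lines\<close>

context generalized_quadrangle
begin

lemma gq_collinear_refl:
  assumes "x \<in> P"
  shows "gq_collinear L I x x"
proof -
  have "{l \<in> L. I x l} \<noteq> {}"
    using lines_per_point[OF assms] by (metis card.empty add_is_0 one_neq_zero)
  then show ?thesis by (auto simp: gq_collinear_def)
qed

lemma gq_collinear_sym: "gq_collinear L I x y \<longleftrightarrow> gq_collinear L I y x"
  by (auto simp: gq_collinear_def)

lemma collinear_points_on_line:
  assumes "l \<in> L" "x \<in> P" "y \<in> P" "x \<noteq> y" "I x l" "I y l"
    and "z \<in> P" "gq_collinear L I z x" "gq_collinear L I z y"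
  shows "I z l"
  using line_points_eq[OF assms(1-6)] assms(7-9) by blast

lemma ex1_projection_point:
  assumes "x \<in> P" "l \<in> L" "\<not> I x l"
  shows "\<exists>!z. z \<in> P \<and> I z l \<and> gq_collinear L I x z"
proof -
  obtain z m where zm: "z \<in> P" "m \<in> L" "I x m" "I z m" "I z l"
    using projection[OF assms] by auto
  moreover have "z' = z" if "z' \<in> P" "m' \<in> L" "I x m'" "I z' m'" "I z' l" for z' m'
  proof -
    have "(z', m') = (z, m)"
      using projection[OF assms] zm that by blast
    then show ?thesis by simp
  qed
  ultimately show ?thesis
    unfolding gq_collinear_def by blast
qed

lemma card_perp:
  assumes x: "x \<in> P"
  shows "card {z \<in> P. gq_collinear L I x z} = 1 + s * (t + 1)"
proof -
  let ?Lx = "{l \<in> L. I x l}"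
  let ?B = "\<lambda>l. {z \<in> P. I z l} - {x}"
  have eq: "{z \<in> P. gq_collinear L I x z} = insert x (\<Union>l\<in>?Lx. ?B l)"
    using x gq_collinear_refl[OF x] by (auto simp: gq_collinear_def)
  have "card (\<Union>l\<in>?Lx. ?B l) = (\<Sum>l\<in>?Lx. card (?B l))"
  proof (rule card_UN_disjoint)
    show "\<forall>l\<in>?Lx. \<forall>m\<in>?Lx. l \<noteq> m \<longrightarrow> ?B l \<inter> ?B m = {}"
      using point_unique x by blast
  qed (use finite_lines finite_points in auto)
  also have "\<dots> = (\<Sum>l\<in>?Lx. s)"
    using points_per_line x finite_points by (intro sum.cong) auto
  also have "\<dots> = s * (t + 1)"
    using lines_per_point[OF x] by simp
  finally have "card (\<Union>l\<in>?Lx. ?B l) = s * (t + 1)" .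
  moreover have "finite (\<Union>l\<in>?Lx. ?B l)" "x \<notin> (\<Union>l\<in>?Lx. ?B l)"
    using finite_lines finite_points by auto
  ultimately show ?thesis
    unfolding eq by (subst card_insert_disjoint) simp_all
qed

lemma card_common_perp_collinear:
  assumes "x \<in> P" "y \<in> P" "x \<noteq> y" "gq_collinear L I x y"
  shows "card {z \<in> P. gq_collinear L I x z \<and> gq_collinear L I y z} = s + 1"
proof -
  obtain l where l: "l \<in> L" "I x l" "I y l"
    using assms by (auto simp: gq_collinear_def)
  then show ?thesis
    using line_points_eq[of l x y] points_per_line[of l] assms gq_collinear_sym by simp
qed

text \<open>The common neighbours are the projections of one point to the lines through the other.\<close>

lemma card_common_perp_noncollinear:
  assumes x: "x \<in> P" and y: "y \<in> P" and nc: "\<not> gq_collinear L I x y"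
  shows "card {z \<in> P. gq_collinear L I x z \<and> gq_collinear L I y z} = t + 1"
proof -
  let ?Lx = "{l \<in> L. I x l}"
  let ?B = "\<lambda>l. {z \<in> P. I z l \<and> gq_collinear L I y z}"
  have eq: "{z \<in> P. gq_collinear L I x z \<and> gq_collinear L I y z} = (\<Union>l\<in>?Lx. ?B l)"
    by (auto simp: gq_collinear_def)
  have "card (\<Union>l\<in>?Lx. ?B l) = (\<Sum>l\<in>?Lx. card (?B l))"
  proof (rule card_UN_disjoint)
    have "x \<notin> ?B l" for l
      using nc gq_collinear_sym by blast
    then show "\<forall>l\<in>?Lx. \<forall>m\<in>?Lx. l \<noteq> m \<longrightarrow> ?B l \<inter> ?B m = {}"
      using point_unique x by blast
  qed (use finite_lines finite_points in auto)
  also have "\<dots> = (\<Sum>l\<in>?Lx. 1)"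
  proof (rule sum.cong)
    fix l assume l: "l \<in> ?Lx"
    then have nl: "\<not> I y l"
      using nc by (auto simp: gq_collinear_def)
    have lL: "l \<in> L" using l by simp
    obtain z where "?B l = {z}"
      using ex1_projection_point[OF y lL nl] by (auto elim!: ex1E)
    then show "card (?B l) = 1" by simp
  qed simp
  also have "\<dots> = t + 1"
    using lines_per_point[OF x] by simp
  finally show ?thesis
    unfolding eq .
qed

section \<open>The quadratic form of collinearity\<close>

text \<open>The entries of the collinearity matrix \<open>N\<close>. Every point counts as collinear with itself, so
  \<open>N\<close> has ones on the diagonal.\<close>

definition coll :: "'p \<Rightarrow> 'p \<Rightarrow> real" where
  "coll x y = of_bool (gq_collinear L I x y)"

lemma coll_sym: "coll x y = coll y x"
  using gq_collinear_sym by (simp add: coll_def)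

text \<open>With the identity \<open>I\<close> and the all-ones matrix \<open>J\<close>, this says that
  \<open>N\<^sup>2 = (s - t) N + s t I + (t + 1) J\<close>. The three numbers of common neighbours, for equal, collinear and
  noncollinear points, determine the three coefficients.\<close>

lemma coll_square:
  assumes "x \<in> P" "y \<in> P"
  shows "(\<Sum>z\<in>P. coll x z * coll y z)
    = (real s - real t) * coll x y + real s * real t * of_bool (x = y) + (real t + 1)"
proof -
  have "(\<Sum>z\<in>P. coll x z * coll y z)
      = (\<Sum>z\<in>P. of_bool (gq_collinear L I x z \<and> gq_collinear L I y z))"
    by (intro sum.cong) (auto simp: coll_def)
  also have "\<dots> = real (card {z \<in> P. gq_collinear L I x z \<and> gq_collinear L I y z})"
    using finite_points by (simp add: sum_of_bool_eq Int_def)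
  finally have eq: "(\<Sum>z\<in>P. coll x z * coll y z) = \<dots>" .
  consider "x = y" | "x \<noteq> y" "gq_collinear L I x y" | "\<not> gq_collinear L I x y" "x \<noteq> y"
    using gq_collinear_refl[OF assms(1)] by blast
  then show ?thesis
  proof cases
    case 1
    then show ?thesis
      unfolding eq using card_perp[OF assms(1)] gq_collinear_refl[OF assms(1)]
      by (simp add: coll_def algebra_simps)
  next
    case 2
    then show ?thesis
      unfolding eq using card_common_perp_collinear[OF assms] by (simp add: coll_def)
  next
    case 3
    then show ?thesis
      unfolding eq using card_common_perp_noncollinear[OF assms] by (simp add: coll_def)
  qed
qed

lemma coll_row_sum:
  assumes "x \<in> P"
  shows "(\<Sum>z\<in>P. coll x z) = 1 + real s * (real t + 1)"
proof -
  have "(\<Sum>z\<in>P. coll x z) = (\<Sum>z\<in>P. coll x z * coll x z)"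
    by (intro sum.cong) (auto simp: coll_def)
  then show ?thesis
    using coll_square[OF assms assms] gq_collinear_refl[OF assms]
    by (simp add: coll_def algebra_simps)
qed

text \<open>Comparing the row sums of both sides of the matrix identity gives the number of points.\<close>

lemma card_points: "card P = (s + 1) * (s * t + 1)"
proof -
  obtain x where x: "x \<in> P"
    using points_nonempty by blast
  define k :: real where "k = 1 + real s * (real t + 1)"
  have "k * k = (\<Sum>z\<in>P. coll x z * k)"
    using coll_row_sum[OF x] by (simp add: k_def flip: sum_distrib_right)
  also have "\<dots> = (\<Sum>z\<in>P. \<Sum>y\<in>P. coll x z * coll y z)"
    using coll_row_sum coll_sym by (intro sum.cong) (auto simp: k_def simp flip: sum_distrib_left)
  also have "\<dots> = (\<Sum>y\<in>P. \<Sum>z\<in>P. coll x z * coll y z)"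
    by (rule sum.swap)
  also have "\<dots> = (\<Sum>y\<in>P. (real s - real t) * coll x y + real s * real t * of_bool (x = y)
      + (real t + 1))"
    using coll_square[OF x] by (intro sum.cong) auto
  also have "\<dots> = (real s - real t) * k + real s * real t + (real t + 1) * real (card P)"
  proof -
    have "(\<Sum>y\<in>P. real s * real t * of_bool (x = y)) = real s * real t"
      using x finite_points by (simp add: of_bool_def if_distrib cong: if_cong)
    then show ?thesis
      using coll_row_sum[OF x] unfolding k_def
      by (simp add: sum.distrib flip: sum_distrib_left)
  qed
  finally have "(real t + 1) * real (card P) = (real t + 1) * ((real s + 1) * (real s * real t + 1))"
    unfolding k_def by (simp add: algebra_simps)
  moreover have "real t + 1 \<noteq> 0"
    by linarith
  ultimately have "real (card P) = (real s + 1) * (real s * real t + 1)"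
    using mult_left_cancel by blast
  then have "real (card P) = real ((s + 1) * (s * t + 1))"
    by (simp add: algebra_simps)
  then show ?thesis
    by (simp only: of_nat_eq_iff)
qed

text \<open>Double counting of the incident pairs.\<close>

lemma card_lines: "card L = (t + 1) * (s * t + 1)"
proof -
  have "(\<Sum>x\<in>P. card {l \<in> L. I x l}) = (s + 1) * card L"
    using sum_multicount[OF finite_points finite_lines, of I "s + 1"] points_per_line by simp
  moreover have "(\<Sum>x\<in>P. card {l \<in> L. I x l}) = card P * (t + 1)"
    using lines_per_point by simp
  ultimately have "(s + 1) * card L = (s + 1) * ((t + 1) * (s * t + 1))"
    unfolding card_points by (simp only: ac_simps)
  then show ?thesis
    by (simp only: mult_cancel1) simp
qed

text \<open>
  The matrix \<open>M = s I - N + J / (s + 1)\<close> is positive semidefinite, because its only eigenvalues are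
  \<open>0\<close> and \<open>s + t\<close>: the quadratic identity for \<open>N\<close>, its constant row sums and the number of points
  give \<open>M\<^sup>2 = (s + t) M\<close>. So the form of \<open>M\<close> at
  a vector \<open>w\<close> is the squared length of \<open>M w\<close> divided by \<open>s + t\<close>.
\<close>

lemma coll_form_le:
  fixes w :: "'p \<Rightarrow> real"
  shows "(\<Sum>z\<in>P. w z * (\<Sum>u\<in>P. w u * coll u z))
    \<le> real s * (\<Sum>z\<in>P. (w z)\<^sup>2) + (\<Sum>z\<in>P. w z)\<^sup>2 / (real s + 1)"
proof -
  define D where "D z = (\<Sum>u\<in>P. w u * coll u z)" for z
  define W where "W = (\<Sum>z\<in>P. w z)"
  define Q where "Q = (\<Sum>z\<in>P. (w z)\<^sup>2)"
  define E where "E = (\<Sum>z\<in>P. w z * D z)"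
  define c where "c = W / (real s + 1)"
  have W: "W = c * (real s + 1)"
    by (simp add: c_def add_nonneg_eq_0_iff)
  have sumD: "(\<Sum>z\<in>P. D z) = W * (1 + real s * (real t + 1))"
  proof -
    have "(\<Sum>z\<in>P. D z) = (\<Sum>u\<in>P. \<Sum>z\<in>P. w u * coll u z)"
      unfolding D_def by (rule sum.swap)
    also have "\<dots> = (\<Sum>u\<in>P. w u * (1 + real s * (real t + 1)))"
      using coll_row_sum by (intro sum.cong) (auto simp flip: sum_distrib_left)
    finally show ?thesis
      unfolding W_def by (simp only: sum_distrib_right)
  qed
  have sumD2: "(\<Sum>z\<in>P. (D z)\<^sup>2) = (real s - real t) * E + real s * real t * Q + (real t + 1) * W\<^sup>2"
  proof -
    have "(\<Sum>z\<in>P. (D z)\<^sup>2) = (\<Sum>z\<in>P. \<Sum>u\<in>P. \<Sum>v\<in>P. w u * w v * (coll u z * coll v z))"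
      unfolding D_def power2_eq_square sum_product by (simp only: ac_simps)
    also have "\<dots> = (\<Sum>u\<in>P. \<Sum>v\<in>P. \<Sum>z\<in>P. w u * w v * (coll u z * coll v z))"
      by (subst sum.swap, rule sum.cong[OF refl], rule sum.swap)
    also have "\<dots> = (\<Sum>u\<in>P. \<Sum>v\<in>P. (real s - real t) * (w u * (w v * coll v u))
        + real s * real t * (w u * (w v * of_bool (u = v))) + (real t + 1) * (w u * w v))"
      by (intro sum.cong refl)
         (simp add: coll_square coll_sym algebra_simps flip: sum_distrib_left)
    also have "\<dots> = (real s - real t) * E
        + real s * real t * (\<Sum>u\<in>P. w u * (\<Sum>v\<in>P. w v * of_bool (u = v))) + (real t + 1) * (W * W)"
      unfolding E_def D_def W_def sum_product
      by (simp add: sum.distrib flip: sum_distrib_left)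
    also have "(\<Sum>u\<in>P. w u * (\<Sum>v\<in>P. w v * of_bool (u = v))) = Q"
      unfolding Q_def using finite_points
      by (intro sum.cong refl) (simp add: of_bool_def if_distrib power2_eq_square cong: if_cong)
    finally show ?thesis
      by (simp add: power2_eq_square)
  qed
  \<comment> \<open>The squared length of \<open>M w\<close>, where \<open>c\<close> is the constant entry of \<open>J w / (s + 1)\<close>.\<close>
  have "0 \<le> (\<Sum>z\<in>P. (real s * w z - D z + c)\<^sup>2)"
    by (simp add: sum_nonneg)
  also have "\<dots> = (\<Sum>z\<in>P. (real s)\<^sup>2 * (w z)\<^sup>2 - 2 * real s * (w z * D z) + (D z)\<^sup>2
      + 2 * c * real s * w z - 2 * c * D z + c\<^sup>2)"
    by (intro sum.cong refl) (simp add: power2_eq_square algebra_simps)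
  also have "\<dots> = (real s)\<^sup>2 * Q - 2 * real s * E + (\<Sum>z\<in>P. (D z)\<^sup>2)
      + 2 * c * real s * W - 2 * c * (\<Sum>z\<in>P. D z) + real (card P) * c\<^sup>2"
    unfolding Q_def E_def W_def
    by (simp add: sum.distrib sum_subtractf sum_distrib_left)
  also have "\<dots> = (real s + real t) * (real s * Q + c * W - E)"
    unfolding sumD sumD2 card_points W by (simp add: power2_eq_square algebra_simps)
  finally have "0 \<le> (real s + real t) * (real s * Q + c * W - E)" .
  moreover have "real s + real t > 0"
    using s_pos by simp
  ultimately have "E \<le> real s * Q + c * W"
    by (simp add: zero_le_mult_iff)
  then show ?thesis
    by (simp add: E_def D_def Q_def W_def c_def power2_eq_square)
qed

text \<open>
  On the vectors that are constant on each of the two sets and vanish elsewhere, the form of the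
  previous lemma is a binary quadratic form. If both sets are nonempty, of sizes \<open>m\<close> and \<open>n\<close>,
  then its determinant is a positive multiple of \<open>(s\<^sup>2 - 1) (s\<^sup>2 - (m - 1) (n - 1))\<close>.
\<close>

lemma bicollinear_cocliques_bound:
  assumes s: "s > 1" and A: "A \<subseteq> P" and B: "B \<subseteq> P" and disj: "A \<inter> B = {}" and ne: "A \<noteq> {}"
    and ncA: "\<And>x y. x \<in> A \<Longrightarrow> y \<in> A \<Longrightarrow> x \<noteq> y \<Longrightarrow> \<not> gq_collinear L I x y"
    and ncB: "\<And>x y. x \<in> B \<Longrightarrow> y \<in> B \<Longrightarrow> x \<noteq> y \<Longrightarrow> \<not> gq_collinear L I x y"
    and AB: "\<And>x y. x \<in> A \<Longrightarrow> y \<in> B \<Longrightarrow> gq_collinear L I x y"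
  shows "(real (card A) - 1) * (real (card B) - 1) \<le> (real s)\<^sup>2"
proof -
  define m where "m = real (card A)"
  define n where "n = real (card B)"
  define r where "r = (real s)\<^sup>2 - 1"
  have fin: "finite A" "finite B"
    using A B finite_points finite_subset by auto
  have m1: "m \<ge> 1"
    using ne fin by (simp add: m_def Suc_le_eq card_gt_0_iff)
  have r0: "r > 0"
    using s by (simp add: r_def)
  have restrict: "(\<Sum>z\<in>P. of_bool (z \<in> C) * h z) = (\<Sum>z\<in>C. h z)" if "C \<subseteq> P" for C and h :: "'p \<Rightarrow> real"
    using that finite_points by (simp add: sum_of_bool_mult_eq inf_absorb2)
  have form: "a\<^sup>2 * m + 2 * a * b * m * n + b\<^sup>2 * n
      \<le> real s * (a\<^sup>2 * m + b\<^sup>2 * n) + (a * m + b * n)\<^sup>2 / (real s + 1)" for a b :: real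
  proof -
    define w where "w z = of_bool (z \<in> A) * a + of_bool (z \<in> B) * b" for z
    have split: "(\<Sum>z\<in>P. w z * h z) = a * (\<Sum>z\<in>A. h z) + b * (\<Sum>z\<in>B. h z)" for h :: "'p \<Rightarrow> real"
      unfolding w_def using restrict[OF A, of "\<lambda>z. a * h z"] restrict[OF B, of "\<lambda>z. b * h z"]
      by (simp add: distrib_right sum.distrib sum_distrib_left mult.assoc)
    have wA: "w z = a" if "z \<in> A" for z
      using that disj by (auto simp: w_def)
    have wB: "w z = b" if "z \<in> B" for z
      using that disj by (auto simp: w_def)
    have same: "(\<Sum>u\<in>C. coll u z) = 1" if "z \<in> C" "C \<subseteq> P" "finite C"
      and "\<And>u. u \<in> C \<Longrightarrow> u \<noteq> z \<Longrightarrow> \<not> gq_collinear L I u z" for C z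
    proof -
      have "(\<Sum>u\<in>C. coll u z) = (\<Sum>u\<in>C. if u = z then 1 else 0)"
        using that gq_collinear_refl by (intro sum.cong) (auto simp: coll_def)
      then show ?thesis using that by simp
    qed
    have DA: "(\<Sum>u\<in>P. w u * coll u z) = a + b * n" if z: "z \<in> A" for z
    proof -
      have "(\<Sum>u\<in>B. coll u z) = n"
        using AB[OF z] gq_collinear_sym by (simp add: coll_def n_def)
      then show ?thesis
        unfolding split using same[OF z A fin(1)] ncA z by simp
    qed
    have DB: "(\<Sum>u\<in>P. w u * coll u z) = a * m + b" if z: "z \<in> B" for z
    proof -
      have "(\<Sum>u\<in>A. coll u z) = m"
        using AB z by (simp add: coll_def m_def)
      then show ?thesis
        unfolding split using same[OF z B fin(2)] ncB z by simp
    qed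
    have "(\<Sum>z\<in>P. w z * (\<Sum>u\<in>P. w u * coll u z)) = a * (m * (a + b * n)) + b * (n * (a * m + b))"
      unfolding split[of "\<lambda>z. \<Sum>u\<in>P. w u * coll u z"] using DA DB by (simp add: m_def n_def)
    moreover have "(\<Sum>z\<in>P. (w z)\<^sup>2) = a * (m * a) + b * (n * b)"
      using split[of w] wA wB by (simp add: m_def n_def power2_eq_square)
    moreover have "(\<Sum>z\<in>P. w z) = a * m + b * n"
      using split[of "\<lambda>_. 1"] by (simp add: m_def n_def)
    ultimately show ?thesis
      using coll_form_le[of w] by (simp add: power2_eq_square algebra_simps)
  qed
  have "0 \<le> a\<^sup>2 * (m * (r + m)) - 2 * a * b * (m * n * real s) + b\<^sup>2 * (n * (r + n))" for a b :: real
  proof -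
    have "(a\<^sup>2 * m + 2 * a * b * m * n + b\<^sup>2 * n) * (real s + 1)
        \<le> (real s * (a\<^sup>2 * m + b\<^sup>2 * n) + (a * m + b * n)\<^sup>2 / (real s + 1)) * (real s + 1)"
      using form by (intro mult_right_mono) auto
    also have "\<dots> = real s * (a\<^sup>2 * m + b\<^sup>2 * n) * (real s + 1) + (a * m + b * n)\<^sup>2"
      by (simp add: distrib_right add_nonneg_eq_0_iff)
    finally show ?thesis
      by (simp add: r_def power2_eq_square algebra_simps)
  qed
  \<comment> \<open>For a fixed second coordinate \<open>r + m\<close>, the form is minimal at this first coordinate.\<close>
  from this[of "n * real s" "r + m"]
  have "0 \<le> (r + m) * n * ((r + m) * (r + n) - m * n * (real s)\<^sup>2)"
    by (simp add: power2_eq_square algebra_simps)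
  moreover have "(r + m) * n > 0 \<or> n = 0"
    using r0 m1 by (cases "card B = 0") (simp_all add: n_def)
  ultimately have "n = 0 \<or> 0 \<le> (r + m) * (r + n) - m * n * (real s)\<^sup>2"
    by (auto simp: zero_le_mult_iff)
  then show ?thesis
  proof
    assume "n = 0"
    have "1 - m \<le> (real s)\<^sup>2"
      using m1 zero_le_power2[of "real s"] by linarith
    then show ?thesis
      using \<open>n = 0\<close> by (simp add: m_def[symmetric] n_def[symmetric])
  next
    assume "0 \<le> (r + m) * (r + n) - m * n * (real s)\<^sup>2"
    also have "\<dots> = r * (r + m + n - m * n)"
      by (simp add: r_def power2_eq_square algebra_simps)
    finally have "0 \<le> r + m + n - m * n"
      using r0 by (simp add: zero_le_mult_iff)
    then show ?thesis
      unfolding m_def[symmetric] n_def[symmetric] by (simp add: r_def algebra_simps)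
  qed
qed

section \<open>Powers of automorphisms on points and lines\<close>

lemma gq_aut_funpow_in_points:
  assumes "g \<in> carrier (gq_aut_group P L I)" "x \<in> P"
  shows "(g ^^ n) x \<in> P"
proof (induction n)
  case (Suc n)
  then show ?case
    using assms(1) permutes_in_image[of g P] by (simp add: gq_aut_group_def)
qed (use assms in simp)

lemma gq_on_lines_funpow_in_lines:
  assumes "g \<in> carrier (gq_aut_group P L I)" "l \<in> L"
  shows "(gq_on_lines P L I g ^^ n) l \<in> L"
  by (induction n) (use assms gq_on_lines(1) in auto)

lemma gq_on_lines_incident:
  assumes g: "g \<in> carrier (gq_aut_group P L I)" and "x \<in> P" "l \<in> L"
  shows "I (g x) (gq_on_lines P L I g l) \<longleftrightarrow> I x l"
proof -
  have p: "g permutes P"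
    using g by (simp add: gq_aut_group_def)
  have "g x \<in> {y \<in> P. I y (gq_on_lines P L I g l)} \<longleftrightarrow> g x \<in> g ` {y \<in> P. I y l}"
    using gq_on_lines(2)[OF g assms(3)] by simp
  then show ?thesis
    using assms(2) permutes_in_image[OF p] permutes_inj[OF p] by (auto dest: injD)
qed

lemma gq_on_lines_funpow_incident:
  assumes g: "g \<in> carrier (gq_aut_group P L I)" and "x \<in> P" "l \<in> L"
  shows "I ((g ^^ n) x) ((gq_on_lines P L I g ^^ n) l) \<longleftrightarrow> I x l"
  by (induction n)
     (simp_all add: gq_on_lines_incident[OF g] gq_aut_funpow_in_points gq_on_lines_funpow_in_lines assms)

lemma gq_aut_funpow_collinear:
  assumes "g \<in> carrier (gq_aut_group P L I)" "x \<in> P" "y \<in> P" "gq_collinear L I x y"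
  shows "gq_collinear L I ((g ^^ n) x) ((g ^^ n) y)"
  using gq_on_lines_funpow_incident[OF assms(1,2), of _ n] gq_on_lines_funpow_incident[OF assms(1,3), of _ n]
    gq_on_lines_funpow_in_lines[OF assms(1), of _ n] assms(4)
  unfolding gq_collinear_def by blast

lemma gq_on_lines_funpow_id:
  assumes g: "g \<in> carrier (gq_aut_group P L I)" and gp: "g ^^ p = id" and l: "l \<in> L"
  shows "(gq_on_lines P L I g ^^ p) l = l"
proof (rule line_eqI)
  show "{x \<in> P. I x ((gq_on_lines P L I g ^^ p) l)} = {x \<in> P. I x l}"
    using gq_on_lines_funpow_incident[OF g _ l, of _ p] gp by auto
qed (use gq_on_lines_funpow_in_lines[OF g l] l in auto)

lemma gq_aut_ord_funpow:
  assumes g: "g \<in> carrier (gq_aut_group P L I)"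
    and ord: "group.ord (gq_aut_group P L I) g = p"
  shows "g ^^ p = id"
proof -
  interpret G: group "gq_aut_group P L I"
    using group_gq_aut_group[OF finite_points] .
  have "g [^]\<^bsub>gq_aut_group P L I\<^esub> (n::nat) = g ^^ n" for n
    by (induction n) (simp_all add: gq_aut_group_def nat_pow_def funpow_swap1 fun_eq_iff)
  then show ?thesis
    using G.pow_ord_eq_1[OF g] ord by (simp add: gq_aut_group_def)
qed

lemma line_through_two_fixed_points_fixed:
  assumes g: "g \<in> carrier (gq_aut_group P L I)" and l: "l \<in> L"
    and xy: "x \<in> P" "y \<in> P" "x \<noteq> y" "I x l" "I y l" "g x = x" "g y = y"
  shows "gq_on_lines P L I g l = l"
proof (rule ccontr)
  assume ne: "gq_on_lines P L I g l \<noteq> l"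
  have "I x (gq_on_lines P L I g l)" "I y (gq_on_lines P L I g l)"
    using gq_on_lines_incident[OF g _ l] xy by metis+
  then show False
    using point_unique[OF gq_on_lines(1)[OF g l] l ne xy(1,2)] xy by blast
qed

section \<open>Automorphisms of order t + 1\<close>

text \<open>
  The points of a fixed line are fixed, as there are fewer than \<^term>\<open>t + 1\<close> of them. If a fixed point
  lies on a fixed line, then at most \<^term>\<open>t\<close> of its \<^term>\<open>t + 1\<close> lines are moved, so none is. Starting
  from one fixed line, projection reaches every point in one further step.
\<close>

lemma fixed_line_imp_id:
  assumes st: "s < t" and p: "Factorial_Ring.prime (t + 1)"
    and g: "g \<in> carrier (gq_aut_group P L I)" and gp: "g ^^ (t + 1) = id"
    and l: "l \<in> L" "gq_on_lines P L I g l = l"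
  shows "g = id"
proof -
  define h where "h = gq_on_lines P L I g"
  have perm: "g permutes P"
    using g by (simp add: gq_aut_group_def)
  have points_fixed: "g x = x" if "x \<in> P" "I x m" "m \<in> L" "h m = m" for x m
  proof (rule all_fixed_if_few_nonfixed[OF p])
    show "g y \<in> {x \<in> P. I x m}" if "y \<in> {x \<in> P. I x m}" for y
      using that gq_on_lines_incident[OF g, of y m] \<open>h m = m\<close> \<open>m \<in> L\<close> permutes_in_image[OF perm]
      by (simp add: h_def)
    have "card {x \<in> {x \<in> P. I x m}. g x \<noteq> x} \<le> card {x \<in> P. I x m}"
      using finite_points by (intro card_mono) auto
    then show "card {x \<in> {x \<in> P. I x m}. g x \<noteq> x} < t + 1"
      using points_per_line[OF \<open>m \<in> L\<close>] st by simp
  qed (use that finite_points gp in auto)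
  have lines_fixed: "h m = m" if "x \<in> P" "g x = x" "k \<in> L" "I x k" "h k = k" "m \<in> L" "I x m" for x k m
  proof (rule all_fixed_if_few_nonfixed[OF p])
    show "h n \<in> {l \<in> L. I x l}" if "n \<in> {l \<in> L. I x l}" for n
      using that gq_on_lines_incident[OF g \<open>x \<in> P\<close>, of n] gq_on_lines(1)[OF g] \<open>g x = x\<close>
      by (simp add: h_def)
    show "(h ^^ (t + 1)) n = n" if "n \<in> {l \<in> L. I x l}" for n
      using that gq_on_lines_funpow_id[OF g gp] unfolding h_def by blast
    have "card {l \<in> {l \<in> L. I x l}. h l \<noteq> l} < card {l \<in> L. I x l}"
      using finite_lines that by (intro psubset_card_mono) auto
    then show "card {l \<in> {l \<in> L. I x l}. h l \<noteq> l} < t + 1"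
      using lines_per_point[OF \<open>x \<in> P\<close>] by simp
  qed (use that finite_lines in auto)
  have "g x = x" for x
  proof (cases "x \<in> P")
    case True
    show ?thesis
    proof (cases "I x l")
      case False
      then obtain y m where ym: "y \<in> P" "m \<in> L" "I x m" "I y m" "I y l"
        using projection[OF True l(1)] by auto
      have "h m = m"
        using lines_fixed[OF ym(1) _ l(1) ym(5) _ ym(2,4)] points_fixed[OF ym(1,5) l(1)] l(2)
        by (simp add: h_def)
      then show ?thesis
        using points_fixed True ym by blast
    qed (use points_fixed True l h_def in simp)
  qed (use perm in \<open>simp add: permutes_not_in\<close>)
  then show ?thesis
    by auto
qed

text \<open>
  The fixed points other than \<^term>\<open>x\<close> are distributed over the \<^term>\<open>s\<close> points other than \<^term>\<open>x\<close> of
  a line through \<^term>\<open>x\<close>, and \<open>b\<close> is a share of at least average size. The points that make up this share are,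
  together with \<^term>\<open>x\<close>, completely joined to an orbit of length \<^term>\<open>t + 1\<close>, which limits their number.
\<close>

lemma prime_order_aut_hyperbolic_bound:
  assumes s: "s > 1" and st: "s < t" and p: "Factorial_Ring.prime (t + 1)"
    and g: "g \<in> carrier (gq_aut_group P L I)" and gp: "g ^^ (t + 1) = id" and ne: "g \<noteq> id"
    and x: "x \<in> P" "g x = x"
  shows "\<exists>b. card {y \<in> P. g y = y} - 1 \<le> b * s \<and> b * t \<le> s\<^sup>2"
proof -
  define h where "h = gq_on_lines P L I g"
  have perm: "g permutes P"
    using g by (simp add: gq_aut_group_def)
  have no_fixed_line: "h l \<noteq> l" if "l \<in> L" for l
    using fixed_line_imp_id[OF st p g gp that] ne by (auto simp: h_def)
  have fixed_noncollinear: "\<not> gq_collinear L I y z"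
    if "y \<in> P" "z \<in> P" "g y = y" "g z = z" "y \<noteq> z" for y z
    using that line_through_two_fixed_points_fixed[OF g, of _ y z] no_fixed_line
    by (auto simp: gq_collinear_def h_def)
  define F where "F = {y \<in> P. g y = y} - {x}"
  have finF: "finite F"
    using finite_points by (simp add: F_def)
  obtain l where l: "l \<in> L" "I x l"
    using gq_collinear_refl[OF x(1)] by (auto simp: gq_collinear_def)
  \<comment> \<open>Projection of the other fixed points to the line \<open>l\<close>.\<close>
  define pr where "pr z = (THE y. y \<in> P \<and> I y l \<and> gq_collinear L I z y)" for z
  have pr: "pr z \<in> P \<and> I (pr z) l \<and> gq_collinear L I z (pr z)" if "z \<in> F" for z
    unfolding pr_def
  proof (rule theI'[OF ex1_projection_point])
    show "z \<in> P" "l \<in> L"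
      using that l by (auto simp: F_def)
    show "\<not> I z l"
      using that l x fixed_noncollinear[of z x] by (auto simp: F_def gq_collinear_def)
  qed
  define Y where "Y = {y \<in> P. I y l} - {x}"
  have cardY: "card Y = s"
    using points_per_line[OF l(1)] x(1) l(2) finite_points by (simp add: Y_def)
  have "pr \<in> F \<rightarrow> Y"
    using pr x(1) fixed_noncollinear[OF _ x(1) _ x(2)] unfolding Y_def F_def by fastforce
  moreover have "finite Y" "Y \<noteq> {}"
    using card_gt_0_iff[of Y] cardY s by simp_all
  ultimately obtain y where y: "y \<in> Y" and big: "card F \<le> card (pr -` {y} \<inter> F) * card Y"
    using pigeonhole_card[OF _ finF] by blast
  define b where "b = card (pr -` {y} \<inter> F)"
  define A where "A = insert x (pr -` {y} \<inter> F)"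
  define orb where "orb = (\<lambda>i. (g ^^ i) y) ` {..<t + 1}"
  have yP: "y \<in> P" "I y l" "y \<noteq> x"
    using y by (auto simp: Y_def)
  have y_nonfixed: "g y \<noteq> y"
    using fixed_noncollinear[of y x] yP x l by (auto simp: gq_collinear_def)
  have x_fixed: "(g ^^ i) x = x" for i
    by (induction i) (use x in auto)
  \<comment> \<open>If two of these images of \<open>y\<close> were equal or collinear, then the corresponding images of \<open>l\<close> would
    coincide, as there are no triangles. So \<open>l\<close> would have a period smaller than the prime \<open>t + 1\<close>.\<close>
  have noncollinear_orbit: "\<not> gq_collinear L I ((g ^^ i) y) ((g ^^ j) y)" if ij: "i < j" "j < t + 1" for i j
  proof
    assume coll: "gq_collinear L I ((g ^^ i) y) ((g ^^ j) y)"
    have on: "I ((g ^^ n) y) ((h ^^ n) l)" "I x ((h ^^ n) l)" "(h ^^ n) l \<in> L" "(g ^^ n) y \<in> P" "(g ^^ n) y \<noteq> x" for n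
    proof -
      show "I ((g ^^ n) y) ((h ^^ n) l)"
        using gq_on_lines_funpow_incident[OF g yP(1) l(1)] yP(2) by (simp add: h_def)
      show "I x ((h ^^ n) l)"
        using gq_on_lines_funpow_incident[OF g x(1) l(1), of n] l(2) x_fixed by (simp add: h_def)
      show "(h ^^ n) l \<in> L" "(g ^^ n) y \<in> P"
        using gq_on_lines_funpow_in_lines[OF g l(1)] gq_aut_funpow_in_points[OF g yP(1)] by (auto simp: h_def)
      have "inj (g ^^ n)"
        using permutes_inj[OF perm] by (rule inj_fn)
      then show "(g ^^ n) y \<noteq> x"
        using yP(3) x_fixed by (metis injD)
    qed
    have "I ((g ^^ j) y) ((h ^^ i) l)"
    proof (rule collinear_points_on_line[OF on(3) x(1) on(4)[of i] on(5)[of i, symmetric] on(2) on(1) on(4)])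
      show "gq_collinear L I ((g ^^ j) y) x"
        using on[of j] by (auto simp: gq_collinear_def)
      show "gq_collinear L I ((g ^^ j) y) ((g ^^ i) y)"
        using coll gq_collinear_sym by blast
    qed
    then have eq: "(h ^^ i) l = (h ^^ j) l"
      using point_unique[OF on(3)[of i] on(3)[of j] _ on(4)[of j] x(1)] on(1,2,5) by blast
    have per: "(h ^^ (t + 1)) l = l"
      using gq_on_lines_funpow_id[OF g gp l(1)] by (simp add: h_def)
    have "(h ^^ (t + 1 - j + i)) l = (h ^^ (t + 1 - j + j)) l"
      using eq unfolding funpow_add by simp
    then have "(h ^^ (t + 1 - j + i)) l = l"
      using per ij by simp
    then have "h l = l"
      by (rule fixed_if_prime_period[OF p per]) (use ij in auto)
    then show False
      using no_fixed_line l(1) by blast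
  qed
  have orbP: "orb \<subseteq> P"
    using gq_aut_funpow_in_points[OF g yP(1)] by (auto simp: orb_def)
  have nc_orb: "\<not> gq_collinear L I u v" if "u \<in> orb" "v \<in> orb" "u \<noteq> v" for u v
    using that noncollinear_orbit gq_collinear_sym unfolding orb_def
    by (smt (verit) imageE lessThan_iff nat_neq_iff)
  have "inj_on (\<lambda>i. (g ^^ i) y) {..<t + 1}"
  proof (rule inj_onI, rule ccontr)
    fix i j assume *: "i \<in> {..<t + 1}" "j \<in> {..<t + 1}" "(g ^^ i) y = (g ^^ j) y" "i \<noteq> j"
    then show False
      using noncollinear_orbit[of i j] noncollinear_orbit[of j i]
        gq_collinear_refl[OF gq_aut_funpow_in_points[OF g yP(1), of i]]
      by (auto simp: nat_neq_iff)
  qed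
  then have card_orb: "card orb = t + 1"
    by (simp add: orb_def card_image)
  have A_fixed: "a \<in> P" "g a = a" "gq_collinear L I a y" if "a \<in> A" for a
    using that x l yP pr by (auto simp: A_def F_def gq_collinear_def)
  have A_orb: "gq_collinear L I a u" if a: "a \<in> A" and u: "u \<in> orb" for a u
  proof -
    obtain i where i: "u = (g ^^ i) y"
      using u by (auto simp: orb_def)
    have "(g ^^ i) a = a"
      by (induction i) (use A_fixed(2)[OF a] in auto)
    then show ?thesis
      using gq_aut_funpow_collinear[OF g A_fixed(1)[OF a] yP(1) A_fixed(3)[OF a], of i] i by simp
  qed
  have ncA: "\<not> gq_collinear L I u v" if "u \<in> A" "v \<in> A" "u \<noteq> v" for u v
    using that fixed_noncollinear A_fixed(1,2) by blast
  have disj: "A \<inter> orb = {}"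
  proof -
    have "\<not> gq_collinear L I y u" if "u \<in> orb" "u \<noteq> y" for u
    proof (rule nc_orb[OF _ that(1) that(2)[symmetric]])
      show "y \<in> orb"
        unfolding orb_def by (rule image_eqI[of _ _ 0]) auto
    qed
    moreover have "y \<notin> A"
      using A_fixed(2) y_nonfixed by blast
    ultimately show ?thesis
      using A_fixed(3) gq_collinear_sym by blast
  qed
  have "(real (card A) - 1) * (real (card orb) - 1) \<le> (real s)\<^sup>2"
    using A_fixed(1) orbP disj ncA nc_orb A_orb
    by (intro bicollinear_cocliques_bound[OF s]) (auto simp: A_def)
  moreover have "card A = b + 1"
    using finF by (simp add: A_def b_def F_def)
  ultimately have "real (b * t) \<le> real (s\<^sup>2)"
    using card_orb by simp
  then have "b * t \<le> s\<^sup>2"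
    by (simp only: of_nat_le_iff)
  moreover have "card {y \<in> P. g y = y} - 1 \<le> b * s"
    using big cardY x finite_points by (simp add: b_def F_def)
  ultimately show ?thesis
    by blast
qed

text \<open>
  The congruence for the number of fixed points bounds it from below, the previous lemma bounds it
  from above. Passing from \<open>c (t + 1) / s \<le> b + s\<close> to the outer ceiling loses nothing, since
  \<open>b + s\<close> is an integer.
\<close>

lemma prime_order_aut_bound:
  assumes s: "s > 1" and st: "s < t" and p: "Factorial_Ring.prime (t + 1)"
    and g: "g \<in> carrier (gq_aut_group P L I)" and ord: "group.ord (gq_aut_group P L I) g = t + 1"
  shows "real t * real_of_int \<lceil>real_of_int \<lceil>(real s)\<^sup>2 / (real t + 1)\<rceil> * ((real t + 1) / real s)\<rceil>
    \<le> real s * (real s + real t)"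
proof -
  interpret G: group "gq_aut_group P L I"
    using group_gq_aut_group[OF finite_points] .
  have perm: "g permutes P"
    using g by (simp add: gq_aut_group_def)
  have gp: "g ^^ (t + 1) = id"
    using gq_aut_ord_funpow[OF g ord] .
  have ne: "g \<noteq> id"
    using G.ord_id ord t_pos by (auto simp: gq_aut_group_def)
  define F where "F = {y \<in> P. g y = y}"
  have "t + 1 dvd card {y \<in> P. g y \<noteq> y}"
    using permutes_in_image[OF perm] by (intro prime_dvd_card_nonfixed[OF p finite_points]) (simp_all only: gp id_apply)
  then obtain k where k: "card {y \<in> P. g y \<noteq> y} = (t + 1) * k"
    by auto
  have "card P = card F + card {y \<in> P. g y \<noteq> y}"
    using finite_points unfolding F_def by (subst card_Un_disjoint[symmetric]) (auto intro: arg_cong[of _ _ card])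
  then have count: "int (card F) + (int s)\<^sup>2 - 1 = (int t + 1) * ((int s)\<^sup>2 + int s - int k)"
    using card_points k by (simp add: power2_eq_square algebra_simps flip: of_nat_add of_nat_mult)
  have "card F \<noteq> 0"
  proof
    \<comment> \<open>Then the prime \<open>t + 1\<close> divides one of the positive numbers \<open>s - 1\<close> and \<open>s + 1\<close>, both at most \<open>t\<close>.\<close>
    assume "card F = 0"
    then have "(int s - 1) * (int s + 1) = (int t + 1) * ((int s)\<^sup>2 + int s - int k)"
      using count by (simp add: power2_eq_square algebra_simps)
    then have "(int t + 1) dvd (int s - 1) * (int s + 1)"
      by (rule dvdI)
    moreover have "Factorial_Ring.prime (int t + 1)"
      using p by (metis of_nat_1 of_nat_add prime_int_nat_transfer nat_int prime_nat_int_transfer)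
    ultimately have "int t + 1 dvd int s - 1 \<or> int t + 1 dvd int s + 1"
      by (simp add: prime_dvd_mult_iff)
    then show False
      using s st by (auto dest: zdvd_imp_le)
  qed
  then have "F \<noteq> {}"
    by auto
  then obtain x where x: "x \<in> P" "g x = x"
    by (auto simp: F_def)
  obtain b where b: "card F - 1 \<le> b * s" "b * t \<le> s\<^sup>2"
    using prime_order_aut_hyperbolic_bound[OF s st p g gp ne x] by (auto simp: F_def)
  define c where "c = (int s)\<^sup>2 + int s - int k"
  have c: "real (card F) - 1 + (real s)\<^sup>2 = (real t + 1) * real_of_int c"
    using arg_cong[OF count, of real_of_int] by (simp add: c_def)
  have "(real s)\<^sup>2 \<le> (real t + 1) * real_of_int c"
    using c \<open>card F \<noteq> 0\<close> by linarith
  then have "\<lceil>(real s)\<^sup>2 / (real t + 1)\<rceil> \<le> c"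
    by (simp add: ceiling_le_iff divide_le_eq mult.commute)
  then have "real_of_int \<lceil>(real s)\<^sup>2 / (real t + 1)\<rceil> * ((real t + 1) / real s)
      \<le> real_of_int c * ((real t + 1) / real s)"
    by (intro mult_right_mono) auto
  also have "\<dots> = (real (card F) - 1 + (real s)\<^sup>2) / real s"
    by (simp add: c)
  also have "\<dots> \<le> (real b * real s + (real s)\<^sup>2) / real s"
  proof -
    have "real (card F) - 1 \<le> real b * real s"
      using b(1) of_nat_mono[OF b(1), where 'a = real] \<open>card F \<noteq> 0\<close> by (simp add: of_nat_diff)
    then show ?thesis
      by (intro divide_right_mono) auto
  qed
  also have "\<dots> = real_of_int (int b + int s)"
    using s by (simp add: field_simps power2_eq_square)
  finally have "\<lceil>real_of_int \<lceil>(real s)\<^sup>2 / (real t + 1)\<rceil> * ((real t + 1) / real s)\<rceil> \<le> int b + int s"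
    by (simp only: ceiling_le_iff)
  then have "real_of_int \<lceil>real_of_int \<lceil>(real s)\<^sup>2 / (real t + 1)\<rceil> * ((real t + 1) / real s)\<rceil>
      \<le> real_of_int (int b + int s)"
    by (simp only: of_int_le_iff)
  then have "real t * real_of_int \<lceil>real_of_int \<lceil>(real s)\<^sup>2 / (real t + 1)\<rceil> * ((real t + 1) / real s)\<rceil>
      \<le> real t * real_of_int (int b + int s)"
    by (intro mult_left_mono) auto
  also have "\<dots> = real (b * t) + real s * real t"
    by (simp add: algebra_simps)
  also have "\<dots> \<le> real (s\<^sup>2) + real s * real t"
    using b(2) by (simp only: add_le_cancel_right of_nat_le_iff)
  finally show ?thesis
    by (simp add: power2_eq_square algebra_simps)
qed

lemma line_transitive_imp_prime_order_aut:
  assumes p: "Factorial_Ring.prime (t + 1)"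
    and trans: "transitive_action (gq_aut_group P L I) L (gq_on_lines P L I)"
  shows "\<exists>g\<in>carrier (gq_aut_group P L I). group.ord (gq_aut_group P L I) g = t + 1"
proof -
  interpret T: transitive_action "gq_aut_group P L I" L "gq_on_lines P L I"
    by (rule trans)
  interpret G: group "gq_aut_group P L I"
    using group_gq_aut_group[OF finite_points] .
  obtain l where l: "l \<in> L"
    using card_lines by (metis card.empty ex_in_conv mult_is_0 add_is_0 one_neq_zero)
  have "orbit (gq_aut_group P L I) (gq_on_lines P L I) l = L"
    using T.unique_orbit[OF l] gq_on_lines(1) l by (auto simp: orbit_def)
  then have "card L dvd order (gq_aut_group P L I)"
    using T.orbit_stabilizer_theorem[OF l] by (metis dvd_triv_left)
  then have "t + 1 dvd order (gq_aut_group P L I)"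
    unfolding card_lines by (rule dvd_mult_left)
  moreover have "finite (carrier (gq_aut_group P L I))"
    by (rule finite_subset[OF _ finite_permutations[OF finite_points]]) (auto simp: gq_aut_group_def)
  ultimately show ?thesis
    using G.exists_prime_order_element[OF p] by blast
qed

end

theorem corollary1p3:
  fixes P :: "'p set" and L :: "'l set" and I :: "'p \<Rightarrow> 'l \<Rightarrow> bool" and s t :: nat
  assumes "thick_generalized_quadrangle P L I s t"
    and "t > s"
    and "Factorial_Ring.prime (t + 1)"
    and "real t * real_of_int \<lceil>real_of_int \<lceil>(real s)\<^sup>2 / (real t + 1)\<rceil> * ((real t + 1) / real s)\<rceil>
           > real s * (real s + real t)"
  shows "\<not> (\<exists>g \<in> carrier (gq_aut_group P L I). group.ord (gq_aut_group P L I) g = t + 1)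
       \<and> \<not> transitive_action (gq_aut_group P L I) L (gq_on_lines P L I)"
proof -
  interpret thick_generalized_quadrangle P L I s t
    by (rule assms(1))
  have "\<not> (\<exists>g \<in> carrier (gq_aut_group P L I). group.ord (gq_aut_group P L I) g = t + 1)"
    using prime_order_aut_bound[OF s_gt_1 assms(2,3)] assms(4) by (meson linorder_not_le)
  then show ?thesis
    using line_transitive_imp_prime_order_aut[OF assms(3)] by blast
qed

end
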